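(* For every integer $n$ and $\varepsilon\in(1/\sqrt{n},1)$, there exists an $n$-vertex graph $G$ such that every $\varepsilon$-triangle cut sparsifier of $G$ has $\Omega(n/\varepsilon^2)$ edges.
   Context: For an undirected graph $G=(V,E,w)$ with nonnegative edge weights, a triangle $T=(V_T,E_T)$ of $G$ is a subgraph isomorphic to $K_3$, with weight $w(T)=\prod_{e\in E_T}w(e)$; it crosses the cut $(S,V\setminus S)$ if $V_T\cap S\ne\emptyset$ and $V_T\cap(V\setminus S)\ne\emptyset$. Let $\mathrm{cut}_G(S,V\setminus S)=\sum_{T\text{ crossing }(S,V\setminus S)}w(T)$. A reweighted subgraph $G'=(V,E',w')$ ($E'\subseteq E$, new nonnegative weights $w'$) is an $\varepsilon$-triangle cut sparsifier of $G$ if for every cut $(S,V\setminus S)$, $(1-\varepsilon)\,\mathrm{cut}_G(S,V\setminus S)\le \mathrm{cut}_{G'}(S,V\setminus S)\le(1+\varepsilon)\,\mathrm{cut}_G(S,V\setminus S)$. The constant hidden in $\Omega(\cdot)$ is universal.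
   Formalization: Stated for n at least 3: for n = 1 the range of epsilon is empty, and for n = 2 no graph has a triangle, so the edgeless graph is always a sparsifier and the bound with a universal positive constant fails. *)

theory Defs
  imports Complex_Main
begin

type_synonym 'a ugraph = "'a set \<times> 'a set set"

record 'a wgraph =
  verts :: "'a set"
  edges :: "'a set set"
  weight :: "'a set \<Rightarrow> real"

text \<open>Finite simple undirected graphs with nonnegative edge weights. An edge is a two-element set
  of vertices; values of the weight function outside the edge set are irrelevant.\<close>

definition wf_wgraph :: "'a wgraph \<Rightarrow> bool" where
  "wf_wgraph G \<longleftrightarrow> finite (verts G) \<and>
     (\<forall>e\<in>edges G. e \<subseteq> verts G \<and> card e = 2) \<and>
     (\<forall>e\<in>edges G. 0 \<le> weight G e)"

definition complete_ugraph :: "nat \<Rightarrow> nat ugraph" where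
  "complete_ugraph k = ({..<k}, {e. e \<subseteq> {..<k} \<and> card e = 2})"

definition ugraph_iso :: "'a ugraph \<Rightarrow> 'b ugraph \<Rightarrow> bool" where
  "ugraph_iso H K \<longleftrightarrow> (\<exists>f. bij_betw f (fst H) (fst K) \<and> (\<lambda>e. f ` e) ` snd H = snd K)"

definition subgraph_of :: "'a ugraph \<Rightarrow> 'a wgraph \<Rightarrow> bool" where
  "subgraph_of H G \<longleftrightarrow> fst H \<subseteq> verts G \<and> snd H \<subseteq> edges G \<and> (\<forall>e\<in>snd H. e \<subseteq> fst H)"

definition triangles :: "'a wgraph \<Rightarrow> 'a ugraph set" where
  "triangles G = {T. subgraph_of T G \<and> ugraph_iso T (complete_ugraph 3)}"

definition triangle_weight :: "'a wgraph \<Rightarrow> 'a ugraph \<Rightarrow> real" where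
  "triangle_weight G T = (\<Prod>e\<in>snd T. weight G e)"

definition crosses :: "'a wgraph \<Rightarrow> 'a ugraph \<Rightarrow> 'a set \<Rightarrow> bool" where
  "crosses G T S \<longleftrightarrow> fst T \<inter> S \<noteq> {} \<and> fst T \<inter> (verts G - S) \<noteq> {}"

definition triangle_cut :: "'a wgraph \<Rightarrow> 'a set \<Rightarrow> real" where
  "triangle_cut G S = (\<Sum>T\<in>{T \<in> triangles G. crosses G T S}. triangle_weight G T)"

definition reweighted_subgraph :: "'a wgraph \<Rightarrow> 'a wgraph \<Rightarrow> bool" where
  "reweighted_subgraph G' G \<longleftrightarrow> wf_wgraph G' \<and> verts G' = verts G \<and> edges G' \<subseteq> edges G"

text \<open>Cuts with \<open>S = {}\<close> or \<open>S = verts G\<close> are included; they impose no condition, both sides being 0.\<close>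

definition triangle_cut_sparsifier :: "real \<Rightarrow> 'a wgraph \<Rightarrow> 'a wgraph \<Rightarrow> bool" where
  "triangle_cut_sparsifier \<epsilon> G G' \<longleftrightarrow> reweighted_subgraph G' G \<and>
     (\<forall>S. S \<subseteq> verts G \<longrightarrow>
        (1 - \<epsilon>) * triangle_cut G S \<le> triangle_cut G' S \<and>
        triangle_cut G' S \<le> (1 + \<epsilon>) * triangle_cut G S)"

end

theory Submission
  imports Defs
begin

text \<open>
  The extremal graph is a cone: an apex \<open>z\<close> joined to all vertices of a complete bipartite graph
  on \<open>L \<union> R\<close>, with \<open>card L\<close> of order \<open>1/\<epsilon>\<^sup>2\<close> and \<open>card R\<close> of order \<open>n\<close>. All its triangles
  contain \<open>z\<close>, so a sparsifier amounts to a matrix \<open>u\<close> on \<open>L \<times> R\<close>, and the cuts avoiding \<open>z\<close> say that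
  \<open>u - 1\<close> has cut norm at most \<open>2 \<epsilon> (card L) (card R)\<close>. If \<open>u\<close> vanishes on most pairs, then most
  columns of \<open>u - 1\<close> have Euclidean norm at least of order \<open>sqrt (card L)\<close>, and by Khintchine's
  inequality random signs on \<open>L\<close> exhibit a cut norm of order \<open>sqrt (card L) (card R)\<close>, which is
  too large.
\<close>

section \<open>Khintchine's inequality\<close>

text \<open>A Rademacher sum: \<open>B\<close> records which signs are positive, so averaging over
  \<open>Pow I\<close> is the expectation over independent uniform signs.\<close>

definition signed_sum :: "('a \<Rightarrow> real) \<Rightarrow> 'a set \<Rightarrow> 'a set \<Rightarrow> real" where
  "signed_sum a I B = (\<Sum>i\<in>I. if i \<in> B then a i else - a i)"

text \<open>Conditioning on the sign of the new index \<open>x\<close>. Leaving \<open>f\<close>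
  arbitrary lets the second and the fourth moment share this induction step.\<close>

lemma sum_Pow_signed_sum_insert:
  assumes "finite I" "x \<notin> I"
  shows "(\<Sum>B\<in>Pow (insert x I). f (signed_sum a (insert x I) B)) =
    (\<Sum>B\<in>Pow I. f (signed_sum a I B + a x) + f (signed_sum a I B - a x))"
proof -
  have out: "signed_sum a (insert x I) B = signed_sum a I B - a x" if "B \<in> Pow I" for B
    using assms that by (auto simp: signed_sum_def)
  have into: "signed_sum a (insert x I) (insert x B) = signed_sum a I B + a x" if "B \<in> Pow I" for B
  proof -
    have "signed_sum a I (insert x B) = signed_sum a I B"
      unfolding signed_sum_def using assms by (intro sum.cong) auto
    then show ?thesis using assms by (simp add: signed_sum_def)
  qed
  have inj: "inj_on (insert x) (Pow I)"
    using assms(2) by (intro inj_onI) (auto simp: insert_ident)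
  have "(\<Sum>B\<in>Pow (insert x I). f (signed_sum a (insert x I) B)) =
    (\<Sum>B\<in>Pow I. f (signed_sum a (insert x I) B)) +
    (\<Sum>B\<in>insert x ` Pow I. f (signed_sum a (insert x I) B))"
    unfolding Pow_insert using assms by (intro sum.union_disjoint) auto
  also have "\<dots> = (\<Sum>B\<in>Pow I. f (signed_sum a I B - a x)) + (\<Sum>B\<in>Pow I. f (signed_sum a I B + a x))"
    using inj out into by (simp add: sum.reindex)
  finally show ?thesis by (simp add: sum.distrib add.commute)
qed

lemma signed_sum_moment2:
  assumes "finite I"
  shows "(\<Sum>B\<in>Pow I. (signed_sum a I B)\<^sup>2) = 2 ^ card I * (\<Sum>i\<in>I. (a i)\<^sup>2)"
  using assms
proof (induction I)
  case empty
  then show ?case by (simp add: signed_sum_def)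
next
  case (insert x I)
  have *: "(s + a x)\<^sup>2 + (s - a x)\<^sup>2 = 2 * s\<^sup>2 + 2 * (a x)\<^sup>2" for s
    by algebra
  have "(\<Sum>B\<in>Pow (insert x I). (signed_sum a (insert x I) B)\<^sup>2) =
      2 * (2 ^ card I * (\<Sum>i\<in>I. (a i)\<^sup>2)) + 2 ^ card I * (2 * (a x)\<^sup>2)"
    using insert
    by (simp add: sum_Pow_signed_sum_insert[where f = "\<lambda>s. s\<^sup>2"] * sum.distrib
        sum_distrib_left[symmetric] card_Pow)
  then show ?case using insert by (simp add: algebra_simps)
qed

text \<open>Controls large values in Khintchine's inequality. The factor 3 is the fourth moment of a
  standard Gaussian and survives the addition of one term.\<close>

lemma signed_sum_moment4:
  assumes "finite I"
  shows "(\<Sum>B\<in>Pow I. (signed_sum a I B) ^ 4) \<le> 3 * 2 ^ card I * (\<Sum>i\<in>I. (a i)\<^sup>2)\<^sup>2"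
  using assms
proof (induction I)
  case empty
  then show ?case by (simp add: signed_sum_def)
next
  case (insert x I)
  define Q where "Q = (\<Sum>i\<in>I. (a i)\<^sup>2)"
  have *: "(s + a x) ^ 4 + (s - a x) ^ 4 = 2 * s ^ 4 + 12 * (a x)\<^sup>2 * s\<^sup>2 + 2 * (a x) ^ 4" for s
    by algebra
  have "(\<Sum>B\<in>Pow (insert x I). (signed_sum a (insert x I) B) ^ 4) =
      2 * (\<Sum>B\<in>Pow I. (signed_sum a I B) ^ 4) + 12 * (a x)\<^sup>2 * (2 ^ card I * Q)
        + 2 ^ card I * (2 * (a x) ^ 4)"
    using insert unfolding Q_def
    by (simp add: sum_Pow_signed_sum_insert[where f = "\<lambda>s. s ^ 4"] * sum.distrib
        sum_distrib_left[symmetric] signed_sum_moment2 card_Pow)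
  \<comment> \<open>Raising the coefficient of the pure fourth power from 2 to 6 completes the
    square of \<open>(a x)\<^sup>2 + Q\<close>.\<close>
  also have "\<dots> \<le> 2 * (3 * 2 ^ card I * Q\<^sup>2) + 12 * (a x)\<^sup>2 * (2 ^ card I * Q)
        + 2 ^ card I * (6 * (a x) ^ 4)"
    using insert.IH unfolding Q_def by (intro add_mono mult_left_mono) auto
  also have "\<dots> = 3 * 2 ^ Suc (card I) * ((a x)\<^sup>2 + Q)\<^sup>2"
    by (simp add: algebra_simps power2_eq_square power4_eq_xxxx)
  finally show ?case using insert by (simp add: Q_def)
qed

text \<open>A pointwise lower bound for the absolute value by a quadratic minus a quartic term turns
  the two moment estimates into a bound on the first absolute moment.\<close>

lemma khintchine:
  assumes "finite I"
  shows "(\<Sum>B\<in>Pow I. \<bar>signed_sum a I B\<bar>) \<ge> 5 / 9 * 2 ^ card I * sqrt (\<Sum>i\<in>I. (a i)\<^sup>2)"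
proof -
  define q where "q = sqrt (\<Sum>i\<in>I. (a i)\<^sup>2)"
  have q2: "q\<^sup>2 = (\<Sum>i\<in>I. (a i)\<^sup>2)" and "q \<ge> 0"
    by (auto simp: q_def sum_nonneg)
  show ?thesis
  proof (cases "q = 0")
    case True
    then show ?thesis by (simp add: q_def[symmetric] sum_nonneg)
  next
    case False
    with \<open>q \<ge> 0\<close> have "q > 0" by simp
    \<comment> \<open>The quartic below touches \<open>q ^ 3 * \<bar>s\<bar>\<close> at \<open>\<bar>s\<bar> = 3 q / 2\<close>, hence the squared factor.\<close>
    have quartic: "q ^ 3 * \<bar>s\<bar> \<ge> q\<^sup>2 * s\<^sup>2 - 4 / 27 * s ^ 4" for s :: real
    proof -
      define t where "t = \<bar>s\<bar>"
      have "t \<ge> 0" by (simp add: t_def)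
      have "q ^ 3 * t - q\<^sup>2 * s\<^sup>2 + 4 / 27 * s ^ 4 = q ^ 3 * t - q\<^sup>2 * t\<^sup>2 + 4 / 27 * t ^ 4"
        by (simp add: t_def power_even_abs)
      also have "q ^ 3 * t - q\<^sup>2 * t\<^sup>2 + 4 / 27 * t ^ 4 = 4 / 27 * t * (t - 3 / 2 * q)\<^sup>2 * (t + 3 * q)"
        by (simp add: field_simps power2_eq_square power3_eq_cube power4_eq_xxxx)
      also have "\<dots> \<ge> 0" using \<open>t \<ge> 0\<close> \<open>q > 0\<close> by simp
      finally have "q ^ 3 * t - q\<^sup>2 * s\<^sup>2 + 4 / 27 * s ^ 4 \<ge> 0" .
      then show ?thesis unfolding t_def by linarith
    qed
    \<comment> \<open>The constant 5/9 is 1 - 3 * 4/27: the second moment enters exactly, the fourth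
      through its bound with factor 3.\<close>
    have "q ^ 3 * (5 / 9 * 2 ^ card I * q) = q\<^sup>2 * (2 ^ card I * q\<^sup>2) - 4 / 27 * (3 * 2 ^ card I * (q\<^sup>2)\<^sup>2)"
      by (simp add: field_simps power2_eq_square power3_eq_cube)
    also have "\<dots> \<le> q\<^sup>2 * (\<Sum>B\<in>Pow I. (signed_sum a I B)\<^sup>2) - 4 / 27 * (\<Sum>B\<in>Pow I. (signed_sum a I B) ^ 4)"
      using signed_sum_moment2[OF assms, of a] signed_sum_moment4[OF assms, of a]
      unfolding q2[symmetric] by (simp add: mult_ac)
    also have "\<dots> \<le> q ^ 3 * (\<Sum>B\<in>Pow I. \<bar>signed_sum a I B\<bar>)"
      unfolding sum_distrib_left sum_subtractf[symmetric] by (intro sum_mono quartic)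
    finally show ?thesis using \<open>q > 0\<close> by (simp add: q_def[symmetric])
  qed
qed

section \<open>Matrices that are close to the all-ones matrix in cut norm\<close>

text \<open>Splitting the rows by \<open>A\<close> and the columns by the sign of their signed sum
  cuts the matrix into four rectangles, each contributing at most \<delta>.\<close>

lemma sum_abs_signed_sum_le:
  fixes M :: "'a \<Rightarrow> 'b \<Rightarrow> real"
  assumes "finite L" "finite R"
    and cut: "\<And>A B. A \<subseteq> L \<Longrightarrow> B \<subseteq> R \<Longrightarrow> \<bar>\<Sum>x\<in>A. \<Sum>y\<in>B. M x y\<bar> \<le> \<delta>"
    and "A \<subseteq> L"
  shows "(\<Sum>y\<in>R. \<bar>signed_sum (\<lambda>x. M x y) L A\<bar>) \<le> 4 * \<delta>"
proof -
  define s where "s y = signed_sum (\<lambda>x. M x y) L A" for y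
  define P where "P = {y \<in> R. s y \<ge> 0}"
  have s: "s y = (\<Sum>x\<in>A. M x y) - (\<Sum>x\<in>L - A. M x y)" for y
  proof -
    have "s y = (\<Sum>x\<in>L - A. if x \<in> A then M x y else - M x y) + (\<Sum>x\<in>A. if x \<in> A then M x y else - M x y)"
      unfolding s_def signed_sum_def using assms by (intro sum.subset_diff) auto
    then show ?thesis by (simp add: sum_negf)
  qed
  have sums: "(\<Sum>y\<in>B. s y) = (\<Sum>x\<in>A. \<Sum>y\<in>B. M x y) - (\<Sum>x\<in>L - A. \<Sum>y\<in>B. M x y)" for B
    unfolding s sum_subtractf by (intro arg_cong2[where f = "(-)"] sum.swap)
  have "(\<Sum>y\<in>R. \<bar>s y\<bar>) = (\<Sum>y\<in>R - P. \<bar>s y\<bar>) + (\<Sum>y\<in>P. \<bar>s y\<bar>)"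
    using assms by (intro sum.subset_diff) (auto simp: P_def)
  also have "\<dots> = - (\<Sum>y\<in>R - P. s y) + (\<Sum>y\<in>P. s y)"
    unfolding sum_negf[symmetric] by (intro arg_cong2[where f = "(+)"] sum.cong) (auto simp: P_def)
  also have "\<dots> \<le> 4 * \<delta>"
    unfolding sums
    using cut[of A P] cut[of A "R - P"] cut[of "L - A" P] cut[of "L - A" "R - P"] \<open>A \<subseteq> L\<close>
    by (auto simp: P_def)
  finally show ?thesis by (simp add: s_def)
qed

text \<open>An averaging argument: otherwise at least half of the columns would be more than half
  full, and together they would hold at least a quarter of all pairs.\<close>

lemma card_sparse_columns:
  assumes "finite L" "finite R"
    and "4 * real (card {(x, y) \<in> L \<times> R. Q x y}) < real (card L * card R)"
  shows "2 * card {y \<in> R. 2 * card {x \<in> L. Q x y} \<le> card L} \<ge> card R"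
proof (rule ccontr)
  define D where "D = {y \<in> R. 2 * card {x \<in> L. Q x y} \<le> card L}"
  assume "\<not> ?thesis"
  then have "2 * card D < card R" by (simp add: D_def)
  moreover have "card (R - D) = card R - card D" "card D \<le> card R"
    using assms by (auto simp: D_def intro!: card_Diff_subset card_mono)
  ultimately have R: "card R \<le> 2 * card (R - D)" by linarith
  \<comment> \<open>The pairs are swapped so that the count proceeds column by column.\<close>
  have "{(x, y) \<in> L \<times> R. Q x y} = prod.swap ` (SIGMA y:R. {x \<in> L. Q x y})"
    by force
  then have "card {(x, y) \<in> L \<times> R. Q x y} = card (SIGMA y:R. {x \<in> L. Q x y})"
    by (simp add: card_image)
  also have "\<dots> = (\<Sum>y\<in>R. card {x \<in> L. Q x y})"
    using assms by (intro card_SigmaI) auto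
  finally have "2 * card {(x, y) \<in> L \<times> R. Q x y} \<ge> (\<Sum>y\<in>R - D. 2 * card {x \<in> L. Q x y})"
    using assms by (simp add: sum_distrib_left[symmetric] sum_mono2)
  moreover have "(\<Sum>y\<in>R - D. 2 * card {x \<in> L. Q x y}) \<ge> (\<Sum>y\<in>R - D. card L)"
    by (intro sum_mono) (auto simp: D_def)
  ultimately have "card (R - D) * card L \<le> 2 * card {(x, y) \<in> L \<times> R. Q x y}"
    by simp
  moreover have "card R * card L \<le> 2 * card (R - D) * card L"
    using R by (rule mult_le_mono1)
  ultimately have "card R * card L \<le> 4 * card {(x, y) \<in> L \<times> R. Q x y}" by linarith
  then have "card L * card R \<le> 4 * card {(x, y) \<in> L \<times> R. Q x y}"
    by (simp add: mult.commute)
  then have "real (card L * card R) \<le> real (4 * card {(x, y) \<in> L \<times> R. Q x y})"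
    by (simp only: of_nat_le_iff)
  with assms(3) show False by simp
qed

text \<open>Each zero of \<open>u\<close> is an entry -1 of \<open>u - 1\<close>, so sparse columns
  have large Euclidean norm. Khintchine's inequality then makes the average over sign patterns
  exceed what the cut norm allows for every single pattern.\<close>

lemma support_of_approx_ones:
  fixes u :: "'a \<Rightarrow> 'b \<Rightarrow> real"
  assumes fin: "finite L" "finite R" and ne: "L \<noteq> {}" "R \<noteq> {}"
    and cut: "\<And>A B. A \<subseteq> L \<Longrightarrow> B \<subseteq> R \<Longrightarrow>
      \<bar>\<Sum>x\<in>A. \<Sum>y\<in>B. u x y - 1\<bar> \<le> 2 * \<epsilon> * real (card L * card R)"
    and \<epsilon>: "2000 * \<epsilon>\<^sup>2 * real (card L) \<le> 1"
  shows "4 * real (card {(x, y) \<in> L \<times> R. u x y \<noteq> 0}) \<ge> real (card L * card R)"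
proof (rule ccontr)
  assume few: "\<not> ?thesis"
  define b m where "b = real (card L)" and "m = real (card R)"
  have pos: "b > 0" "m > 0" using fin ne by (auto simp: b_def m_def card_gt_0_iff)
  define D where "D = {y \<in> R. 2 * card {x \<in> L. u x y \<noteq> 0} \<le> card L}"
  have "2 * card D \<ge> card R"
    unfolding D_def using few fin by (intro card_sparse_columns) auto
  then have D: "real (card D) \<ge> m / 2" by (simp add: m_def)
  define M where "M x y = u x y - 1" for x y
  have norm: "(\<Sum>x\<in>L. (M x y)\<^sup>2) \<ge> b / 2" if "y \<in> D" for y
  proof -
    have "card {x \<in> L. u x y \<noteq> 0} + card {x \<in> L. u x y = 0} = card L"
      using fin by (subst card_Un_disjoint[symmetric]) (auto intro: arg_cong[where f = card])
    moreover have "2 * card {x \<in> L. u x y \<noteq> 0} \<le> card L" using that by (simp add: D_def)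
    ultimately have "b / 2 \<le> real (card {x \<in> L. u x y = 0})" by (simp add: b_def)
    also have "\<dots> = (\<Sum>x\<in>{x \<in> L. u x y = 0}. (M x y)\<^sup>2)" by (simp add: M_def)
    also have "\<dots> \<le> (\<Sum>x\<in>L. (M x y)\<^sup>2)" using fin by (intro sum_mono2) auto
    finally show ?thesis .
  qed
  have "m / 2 * (5 / 9 * 2 ^ card L * sqrt (b / 2)) \<le> (\<Sum>y\<in>D. 5 / 9 * 2 ^ card L * sqrt (b / 2))"
    using D pos by (simp add: mult_right_mono)
  also have "\<dots> \<le> (\<Sum>y\<in>D. 5 / 9 * 2 ^ card L * sqrt (\<Sum>x\<in>L. (M x y)\<^sup>2))"
    using norm by (intro sum_mono mult_left_mono real_sqrt_le_mono) auto
  also have "\<dots> \<le> (\<Sum>y\<in>D. \<Sum>A\<in>Pow L. \<bar>signed_sum (\<lambda>x. M x y) L A\<bar>)"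
    using fin by (intro sum_mono khintchine)
  also have "\<dots> \<le> (\<Sum>y\<in>R. \<Sum>A\<in>Pow L. \<bar>signed_sum (\<lambda>x. M x y) L A\<bar>)"
    using fin by (intro sum_mono2) (auto simp: D_def intro: sum_nonneg)
  \<comment> \<open>Khintchine fixes a column and averages over signs; the cut norm bound fixes the
    signs and sums over columns.\<close>
  also have "\<dots> = (\<Sum>A\<in>Pow L. \<Sum>y\<in>R. \<bar>signed_sum (\<lambda>x. M x y) L A\<bar>)"
    by (rule sum.swap)
  also have "\<dots> \<le> (\<Sum>A\<in>Pow L. 4 * (2 * \<epsilon> * (b * m)))"
  proof (intro sum_mono)
    fix A assume "A \<in> Pow L"
    then show "(\<Sum>y\<in>R. \<bar>signed_sum (\<lambda>x. M x y) L A\<bar>) \<le> 4 * (2 * \<epsilon> * (b * m))"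
      using fin cut by (intro sum_abs_signed_sum_le) (auto simp: b_def m_def M_def)
  qed
  also have "\<dots> = 2 ^ card L * (8 * \<epsilon> * b * m)"
    using fin by (simp add: card_Pow)
  finally have "(m * 2 ^ card L) * (5 / 18 * sqrt (b / 2)) \<le> (m * 2 ^ card L) * (8 * \<epsilon> * b)"
    by (simp add: algebra_simps)
  then have *: "5 / 18 * sqrt (b / 2) \<le> 8 * \<epsilon> * b"
    by (rule mult_left_le_imp_le) (use pos in simp)
  have "(5 / 18 * sqrt (b / 2))\<^sup>2 \<le> (8 * \<epsilon> * b)\<^sup>2"
    by (rule power_mono[OF *]) (use pos in simp)
  then have "25 / 648 * b \<le> (64 * \<epsilon>\<^sup>2 * b) * b"
    using pos by (simp add: power_mult_distrib power_divide power2_eq_square)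
  \<comment> \<open>By hypothesis the right side is at most 64/2000 = 0.032, whereas 25/648 exceeds
    0.038; this is what the constant 2000 is chosen for.\<close>
  then have "25 / 648 \<le> 64 * \<epsilon>\<^sup>2 * b"
    using pos by simp
  with \<epsilon> show False by (simp add: b_def)
qed

section \<open>Triangles of the cone over a complete bipartite graph\<close>

lemma pairs_below_3: "{e. e \<subseteq> {..<3::nat} \<and> card e = 2} = {{0, 1}, {0, 2}, {1, 2}}"
proof -
  have three: "{..<3::nat} = {0, 1, 2}" by auto
  show ?thesis
  proof (intro equalityI subsetI)
    fix e :: "nat set" assume "e \<in> {e. e \<subseteq> {..<3} \<and> card e = 2}"
    then obtain p q where e: "e = {p, q}" "p \<noteq> q" and "p \<in> {0, 1, 2}" "q \<in> {0, 1, 2}"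
      unfolding three by (auto simp: card_2_iff)
    then show "e \<in> {{0, 1}, {0, 2}, {1, 2}}"
      by (elim insertE emptyE) (simp_all add: insert_commute)
  qed auto
qed

text \<open>Trades the isomorphism with the complete graph for three named vertices, namely the
  preimages of 0, 1 and 2.\<close>

lemma mem_triangles_iff:
  "T \<in> triangles G \<longleftrightarrow>
    (\<exists>a b c. a \<noteq> b \<and> a \<noteq> c \<and> b \<noteq> c \<and> {a, b, c} \<subseteq> verts G \<and>
      {{a, b}, {a, c}, {b, c}} \<subseteq> edges G \<and> T = ({a, b, c}, {{a, b}, {a, c}, {b, c}}))"
    (is "_ \<longleftrightarrow> ?rhs")
proof
  assume "T \<in> triangles G"
  then obtain f where sub: "subgraph_of T G" and f: "bij_betw f (fst T) {..<3::nat}"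
    and img: "(`) f ` snd T = {{0, 1}, {0, 2}, {1, 2}}"
    by (auto simp: triangles_def ugraph_iso_def complete_ugraph_def pairs_below_3)
  define g where "g = inv_into (fst T) f"
  have g: "bij_betw g {..<3} (fst T)" using f by (simp add: g_def bij_betw_inv_into)
  have three: "{..<3::nat} = {0, 1, 2}" by auto
  have fst: "fst T = {g 0, g 1, g 2}"
    using bij_betw_imp_surj_on[OF g] by (simp add: three)
  have dist: "g 0 \<noteq> g 1" "g 0 \<noteq> g 2" "g 1 \<noteq> g 2"
    using bij_betw_imp_inj_on[OF g] by (auto simp: three)
  \<comment> \<open>\<open>g\<close> inverts \<open>f\<close> only on \<open>fst T\<close>, so it
    matters that every edge of a subgraph lies inside its vertex set.\<close>
  have "g ` f ` e = e" if "e \<in> snd T" for e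
  proof -
    have "e \<subseteq> fst T" using sub that by (auto simp: subgraph_of_def)
    then have "\<forall>v\<in>e. g (f v) = v"
      using bij_betw_imp_inj_on[OF f] by (auto simp: g_def)
    then show ?thesis by (auto simp: image_image)
  qed
  then have "snd T = (`) g ` (`) f ` snd T" by (auto simp: image_image)
  also have "\<dots> = {{g 0, g 1}, {g 0, g 2}, {g 1, g 2}}" by (simp add: img)
  finally have snd: "snd T = {{g 0, g 1}, {g 0, g 2}, {g 1, g 2}}" .
  have "T = ({g 0, g 1, g 2}, {{g 0, g 1}, {g 0, g 2}, {g 1, g 2}})"
    using fst snd by (simp add: prod_eq_iff)
  moreover have "{g 0, g 1, g 2} \<subseteq> verts G" "{{g 0, g 1}, {g 0, g 2}, {g 1, g 2}} \<subseteq> edges G"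
    using sub fst snd by (auto simp: subgraph_of_def)
  ultimately show ?rhs using dist by blast
next
  assume ?rhs
  then obtain a b c where d: "a \<noteq> b" "a \<noteq> c" "b \<noteq> c"
    and sub: "{a, b, c} \<subseteq> verts G" "{{a, b}, {a, c}, {b, c}} \<subseteq> edges G"
    and T: "T = ({a, b, c}, {{a, b}, {a, c}, {b, c}})" by blast
  define f where "f v = (if v = a then 0 else if v = b then 1 else 2 :: nat)" for v
  have "bij_betw f (fst T) {..<3}"
    using d by (auto simp: bij_betw_def inj_on_def f_def T)
  moreover have "(`) f ` snd T = {{0, 1}, {0, 2}, {1, 2}}"
    using d by (auto simp: f_def T)
  ultimately show "T \<in> triangles G"
    using sub by (auto simp: triangles_def ugraph_iso_def complete_ugraph_def pairs_below_3 subgraph_of_def T)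
qed

definition cone_biclique :: "'a \<Rightarrow> 'a set \<Rightarrow> 'a set \<Rightarrow> 'a wgraph" where
  "cone_biclique z L R = \<lparr>verts = insert z (L \<union> R),
     edges = (\<lambda>v. {z, v}) ` (L \<union> R) \<union> (\<lambda>(x, y). {x, y}) ` (L \<times> R), weight = (\<lambda>_. 1)\<rparr>"

definition apex_triangle :: "'a \<Rightarrow> 'a \<times> 'a \<Rightarrow> 'a ugraph" where
  "apex_triangle z p = ({z, fst p, snd p}, {{z, fst p}, {z, snd p}, {fst p, snd p}})"

text \<open>The matrix \<open>u\<close> of the cone argument. The default 0 is explicit because
  weights outside the edge set are arbitrary.\<close>

definition apex_weight :: "'a wgraph \<Rightarrow> 'a \<Rightarrow> 'a \<Rightarrow> 'a \<Rightarrow> real" where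
  "apex_weight H z x y = (if {{z, x}, {z, y}, {x, y}} \<subseteq> edges H
     then weight H {z, x} * weight H {z, y} * weight H {x, y} else 0)"

locale cone =
  fixes z :: 'a and L R :: "'a set"
  assumes fin: "finite L" "finite R"
    and disj: "L \<inter> R = {}" "z \<notin> L" "z \<notin> R"
begin

lemma wf_cone_biclique: "wf_wgraph (cone_biclique z L R)"
proof -
  have "x \<noteq> y" if "x \<in> L" "y \<in> R" for x y using disj that by auto
  then show ?thesis
    using fin disj by (auto simp: wf_wgraph_def cone_biclique_def card_insert_if)
qed

lemma edge_cone_biclique_iff:
  "{p, q} \<in> edges (cone_biclique z L R) \<longleftrightarrow>
    p = z \<and> q \<in> L \<union> R \<or> q = z \<and> p \<in> L \<union> R \<or> p \<in> L \<and> q \<in> R \<or> q \<in> L \<and> p \<in> R"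
proof -
  have "{p, q} \<in> edges (cone_biclique z L R) \<longleftrightarrow>
    (\<exists>v\<in>L \<union> R. {p, q} = {z, v}) \<or> (\<exists>x\<in>L. \<exists>y\<in>R. {p, q} = {x, y})"
    by (simp add: cone_biclique_def image_iff)
  then show ?thesis unfolding doubleton_eq_iff by blast
qed

text \<open>Without \<open>z\<close> the graph is bipartite, so a triangle consists of
  \<open>z\<close> and one vertex from each side.\<close>

lemma triangles_cone:
  assumes "verts H = verts (cone_biclique z L R)" "edges H \<subseteq> edges (cone_biclique z L R)"
  shows "triangles H = apex_triangle z ` {(x, y) \<in> L \<times> R. {{z, x}, {z, y}, {x, y}} \<subseteq> edges H}"
proof (intro equalityI subsetI)
  fix T assume "T \<in> triangles H"
  then obtain a b c where d: "a \<noteq> b" "a \<noteq> c" "b \<noteq> c"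
    and e: "{a, b} \<in> edges H" "{a, c} \<in> edges H" "{b, c} \<in> edges H"
    and T: "T = ({a, b, c}, {{a, b}, {a, c}, {b, c}})"
    by (auto simp: mem_triangles_iff)
  have "{a, b} \<in> edges (cone_biclique z L R)" "{a, c} \<in> edges (cone_biclique z L R)"
    "{b, c} \<in> edges (cone_biclique z L R)" using e assms(2) by auto
  \<comment> \<open>The six assignments of the unordered vertices \<open>a\<close>,
    \<open>b\<close>, \<open>c\<close> to the apex, the left side and the right side.\<close>
  then consider "a = z" "b \<in> L" "c \<in> R" | "a = z" "c \<in> L" "b \<in> R" | "b = z" "a \<in> L" "c \<in> R"
    | "b = z" "c \<in> L" "a \<in> R" | "c = z" "a \<in> L" "b \<in> R" | "c = z" "b \<in> L" "a \<in> R"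
    using disj d unfolding edge_cone_biclique_iff by auto
  then obtain x y where xy: "x \<in> L" "y \<in> R"
    and eq: "{{z, x}, {z, y}, {x, y}} = {{a, b}, {a, c}, {b, c}}" "{z, x, y} = {a, b, c}"
  proof cases
    case 1
    then show ?thesis by (intro that[of b c]) (simp_all add: insert_commute)
  next
    case 2
    then show ?thesis by (intro that[of c b]) (simp_all add: insert_commute)
  next
    case 3
    then show ?thesis by (intro that[of a c]) (simp_all add: insert_commute)
  next
    case 4
    then show ?thesis by (intro that[of c a]) (simp_all add: insert_commute)
  next
    case 5
    then show ?thesis by (intro that[of a b]) (simp_all add: insert_commute)
  next
    case 6
    then show ?thesis by (intro that[of b a]) (simp_all add: insert_commute)
  qed
  have "{{z, x}, {z, y}, {x, y}} \<subseteq> edges H" unfolding eq using e by simp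
  moreover have "T = apex_triangle z (x, y)" by (simp add: apex_triangle_def eq T)
  ultimately show "T \<in> apex_triangle z ` {(x, y) \<in> L \<times> R. {{z, x}, {z, y}, {x, y}} \<subseteq> edges H}"
    using xy by (intro image_eqI[where x = "(x, y)"]) simp_all
next
  fix T assume "T \<in> apex_triangle z ` {(x, y) \<in> L \<times> R. {{z, x}, {z, y}, {x, y}} \<subseteq> edges H}"
  then obtain x y where xy: "x \<in> L" "y \<in> R" "{{z, x}, {z, y}, {x, y}} \<subseteq> edges H"
    "T = apex_triangle z (x, y)" by auto
  moreover have "z \<noteq> x" "z \<noteq> y" "x \<noteq> y" using disj xy by auto
  moreover have "{z, x, y} \<subseteq> verts H" using xy assms(1) by (simp add: cone_biclique_def)
  ultimately show "T \<in> triangles H"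
    unfolding mem_triangles_iff apex_triangle_def
    by (intro exI[of _ z] exI[of _ x] exI[of _ y]) simp
qed

text \<open>The vertex set already determines the pair, since \<open>{z}\<close>, \<open>L\<close>
  and \<open>R\<close> are pairwise disjoint.\<close>

lemma inj_apex_triangle: "inj_on (apex_triangle z) (L \<times> R)"
proof (rule inj_onI)
  fix p q assume pq: "p \<in> L \<times> R" "q \<in> L \<times> R" "apex_triangle z p = apex_triangle z q"
  then have "{z, fst p, snd p} = {z, fst q, snd q}" by (simp add: apex_triangle_def)
  then have "fst p \<in> {z, fst q, snd q}" "snd p \<in> {z, fst q, snd q}" by blast+
  with pq(1,2) disj show "p = q" by (auto simp: prod_eq_iff)
qed

text \<open>The apex lies outside \<open>S\<close> and belongs to every triangle, so a triangle
  crosses exactly when one of its other two vertices is in \<open>S\<close>.\<close>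

lemma triangle_cut_cone:
  assumes H: "verts H = verts (cone_biclique z L R)" "edges H \<subseteq> edges (cone_biclique z L R)"
    and S: "S \<subseteq> L \<union> R"
  shows "triangle_cut H S = (\<Sum>(x, y)\<in>L \<times> R. if x \<in> S \<or> y \<in> S then apex_weight H z x y else 0)"
proof -
  define P where "P = {(x, y) \<in> L \<times> R. {{z, x}, {z, y}, {x, y}} \<subseteq> edges H \<and> (x \<in> S \<or> y \<in> S)}"
  have z: "z \<in> verts H" "z \<notin> S" using H(1) S disj by (auto simp: cone_biclique_def)
  have "{T \<in> triangles H. crosses H T S} = apex_triangle z ` P"
    unfolding triangles_cone[OF H] P_def using z by (auto simp: crosses_def apex_triangle_def)
  then have "triangle_cut H S = (\<Sum>p\<in>P. triangle_weight H (apex_triangle z p))"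
    unfolding triangle_cut_def using inj_on_subset[OF inj_apex_triangle, of P]
    by (simp add: sum.reindex P_def subset_iff)
  also have "\<dots> = (\<Sum>(x, y)\<in>P. apex_weight H z x y)"
  proof (rule sum.cong)
    fix p assume "p \<in> P"
    moreover from this obtain x y where p: "p = (x, y)" "x \<in> L" "y \<in> R" by (auto simp: P_def)
    \<comment> \<open>The product runs over a set of edges, so distinctness is what yields three
      factors.\<close>
    moreover have "{z, x} \<noteq> {z, y}" "{z, x} \<noteq> {x, y}" "{z, y} \<noteq> {x, y}"
      using disj p by (auto simp: doubleton_eq_iff)
    ultimately show "triangle_weight H (apex_triangle z p) = (case p of (x, y) \<Rightarrow> apex_weight H z x y)"
      by (simp add: triangle_weight_def apex_triangle_def apex_weight_def P_def)
  qed simp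
  also have "\<dots> = (\<Sum>(x, y)\<in>L \<times> R. if x \<in> S \<or> y \<in> S then apex_weight H z x y else 0)"
    using fin by (intro sum.mono_neutral_cong_left) (auto simp: P_def apex_weight_def split: if_splits)
  finally show ?thesis .
qed

text \<open>Every triangle crosses the cut \<open>L \<union> R\<close>, which isolates the apex.
  Those that fail to cross the second cut are exactly the ones over \<open>A \<times> B\<close>, so
  rectangle sums are differences of cuts.\<close>

lemma triangle_cut_cone_complement:
  assumes K: "verts K = verts (cone_biclique z L R)" "edges K \<subseteq> edges (cone_biclique z L R)"
    and AB: "A \<subseteq> L" "B \<subseteq> R"
  shows "(\<Sum>x\<in>A. \<Sum>y\<in>B. apex_weight K z x y) =
    triangle_cut K (L \<union> R) - triangle_cut K ((L - A) \<union> (R - B))"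
proof -
  have "(\<Sum>x\<in>A. \<Sum>y\<in>B. apex_weight K z x y) = (\<Sum>(x, y)\<in>A \<times> B. apex_weight K z x y)"
    by (simp add: sum.cartesian_product)
  also have "\<dots> = (\<Sum>(x, y)\<in>L \<times> R. if x \<in> A \<and> y \<in> B then apex_weight K z x y else 0)"
    using fin AB by (intro sum.mono_neutral_cong_left) (auto split: if_splits)
  also have "\<dots> = triangle_cut K (L \<union> R) - triangle_cut K ((L - A) \<union> (R - B))"
  proof -
    have sub: "(L - A) \<union> (R - B) \<subseteq> L \<union> R" by blast
    show ?thesis
      unfolding triangle_cut_cone[OF K subset_refl] triangle_cut_cone[OF K sub] sum_subtractf[symmetric]
      using disj by (intro sum.cong) auto
  qed
  finally show ?thesis .
qed

lemma apex_weight_cone_biclique: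
  assumes "x \<in> L" "y \<in> R"
  shows "apex_weight (cone_biclique z L R) z x y = 1"
proof -
  have "weight (cone_biclique z L R) e = 1" for e by (simp add: cone_biclique_def)
  then show ?thesis using assms by (simp add: apex_weight_def edge_cone_biclique_iff)
qed

text \<open>A nonzero entry forces the edge \<open>{x, y}\<close> to be present, and disjointness of
  \<open>L\<close> and \<open>R\<close> recovers the ordered pair from it.\<close>

lemma card_edges_ge_support:
  assumes "edges H \<subseteq> edges (cone_biclique z L R)"
  shows "card {(x, y) \<in> L \<times> R. apex_weight H z x y \<noteq> 0} \<le> card (edges H)"
proof (rule card_inj_on_le[where f = "\<lambda>(x, y). {x, y}"])
  show "inj_on (\<lambda>(x, y). {x, y}) {(x, y) \<in> L \<times> R. apex_weight H z x y \<noteq> 0}"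
    using disj by (auto simp: inj_on_def doubleton_eq_iff)
  show "(\<lambda>(x, y). {x, y}) ` {(x, y) \<in> L \<times> R. apex_weight H z x y \<noteq> 0} \<subseteq> edges H"
    by (auto simp: apex_weight_def split: if_splits)
  have "finite (edges (cone_biclique z L R))" using fin by (simp add: cone_biclique_def)
  with assms show "finite (edges H)" by (rule finite_subset)
qed

section \<open>Sparsifiers of the cone\<close>

context
  fixes \<epsilon> :: real and H :: "'a wgraph"
  assumes sparsifier: "triangle_cut_sparsifier \<epsilon> (cone_biclique z L R) H"
begin

lemma sparsifier_subgraph:
  "verts H = verts (cone_biclique z L R)" "edges H \<subseteq> edges (cone_biclique z L R)"
  using sparsifier by (simp_all add: triangle_cut_sparsifier_def reweighted_subgraph_def)

lemma sparsifier_cut: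
  assumes "S \<subseteq> L \<union> R"
  shows "\<bar>triangle_cut H S - triangle_cut (cone_biclique z L R) S\<bar>
    \<le> \<epsilon> * triangle_cut (cone_biclique z L R) S"
proof -
  have "S \<subseteq> verts (cone_biclique z L R)" using assms by (auto simp: cone_biclique_def)
  with sparsifier show ?thesis
    unfolding triangle_cut_sparsifier_def by (auto simp: algebra_simps abs_le_iff)
qed

text \<open>A rectangle sum is a difference of two cuts, hence the factor 2. Each cut of the
  unit-weight cone is at most its number of triangles, which makes the relative error
  absolute.\<close>

lemma sparsifier_cut_norm:
  assumes "0 \<le> \<epsilon>" "A \<subseteq> L" "B \<subseteq> R"
  shows "\<bar>\<Sum>x\<in>A. \<Sum>y\<in>B. apex_weight H z x y - 1\<bar> \<le> 2 * \<epsilon> * real (card L * card R)"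
proof -
  define G where "G = cone_biclique z L R"
  define S where "S = (L - A) \<union> (R - B)"
  have le: "triangle_cut G S' \<le> real (card L * card R)" if "S' \<subseteq> L \<union> R" for S'
  proof -
    have "triangle_cut G S' \<le> (\<Sum>(x, y)\<in>L \<times> R. 1)"
      unfolding G_def triangle_cut_cone[OF refl subset_refl that]
      by (intro sum_mono) (auto simp: apex_weight_cone_biclique)
    then show ?thesis by (simp add: case_prod_unfold card_cartesian_product)
  qed
  have "(\<Sum>x\<in>A. \<Sum>y\<in>B. apex_weight G z x y) = (\<Sum>x\<in>A. \<Sum>y\<in>B. 1)"
    using assms unfolding G_def by (intro sum.cong refl apex_weight_cone_biclique) auto
  then have "(\<Sum>x\<in>A. \<Sum>y\<in>B. apex_weight H z x y - 1) =
      (triangle_cut H (L \<union> R) - triangle_cut G (L \<union> R)) - (triangle_cut H S - triangle_cut G S)"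
    using triangle_cut_cone_complement[OF sparsifier_subgraph assms(2,3)]
      triangle_cut_cone_complement[OF refl subset_refl assms(2,3)]
    unfolding G_def S_def sum_subtractf by linarith
  moreover have "\<bar>triangle_cut H S' - triangle_cut G S'\<bar> \<le> \<epsilon> * real (card L * card R)"
    if "S' \<subseteq> L \<union> R" for S'
    using sparsifier_cut[OF that] mult_left_mono[OF le[OF that] assms(1)] unfolding G_def by linarith
  from this[of "L \<union> R"] this[of S]
  have "\<bar>triangle_cut H (L \<union> R) - triangle_cut G (L \<union> R)\<bar> \<le> \<epsilon> * real (card L * card R)"
    "\<bar>triangle_cut H S - triangle_cut G S\<bar> \<le> \<epsilon> * real (card L * card R)"
    by (auto simp: S_def)
  ultimately show ?thesis by linarith
qed

lemma sparsifier_card_edges_ge: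
  assumes "0 \<le> \<epsilon>" "L \<noteq> {}" "R \<noteq> {}" "2000 * \<epsilon>\<^sup>2 * real (card L) \<le> 1"
  shows "4 * real (card (edges H)) \<ge> real (card L * card R)"
proof -
  have "real (card L * card R) \<le> 4 * real (card {(x, y) \<in> L \<times> R. apex_weight H z x y \<noteq> 0})"
    using assms fin sparsifier_cut_norm by (intro support_of_approx_ones[where \<epsilon> = \<epsilon>])
  also have "\<dots> \<le> 4 * real (card (edges H))"
    using card_edges_ge_support[OF sparsifier_subgraph(2)] by simp
  finally show ?thesis .
qed

text \<open>Serves the range where \<epsilon> is too large for the cut norm argument. The cut around
  a single \<open>y\<close> in \<open>R\<close> has positive weight, and a relative error below 1
  cannot erase it, so every column keeps a nonzero entry.\<close>

lemma sparsifier_card_edges_ge_card: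
  assumes "\<epsilon> < 1" "L \<noteq> {}"
  shows "card (edges H) \<ge> card R"
proof -
  have "\<exists>x\<in>L. apex_weight H z x y \<noteq> 0" if y: "y \<in> R" for y
  proof (rule ccontr)
    assume none: "\<not> ?thesis"
    have S: "{y} \<subseteq> L \<union> R" using y by simp
    have yL: "y \<notin> L" using y disj by auto
    have "triangle_cut H {y} = 0"
      unfolding triangle_cut_cone[OF sparsifier_subgraph S] using none yL
      by (intro sum.neutral) auto
    moreover have "0 < triangle_cut (cone_biclique z L R) {y}"
    proof -
      obtain x where x: "x \<in> L" using assms(2) by auto
      show ?thesis
        unfolding triangle_cut_cone[OF refl subset_refl S] using fin x y
        by (intro sum_pos2[where i = "(x, y)"]) (auto simp: apex_weight_cone_biclique)
    qed
    moreover have "\<epsilon> * triangle_cut (cone_biclique z L R) {y} < 1 * triangle_cut (cone_biclique z L R) {y}"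
      using assms(1) calculation(2) by (intro mult_strict_right_mono)
    ultimately show False using sparsifier_cut[OF S] by simp
  qed
  then have "R \<subseteq> snd ` {(x, y) \<in> L \<times> R. apex_weight H z x y \<noteq> 0}" by force
  then have "card R \<le> card {(x, y) \<in> L \<times> R. apex_weight H z x y \<noteq> 0}"
    using fin by (intro surj_card_le) (auto intro: finite_subset[of _ "L \<times> R"])
  also have "\<dots> \<le> card (edges H)" by (rule card_edges_ge_support[OF sparsifier_subgraph(2)])
  finally show ?thesis .
qed

end

end

section \<open>Choice of parameters and the lower bound\<close>

lemma sparsifier_lower_bound:
  fixes n :: nat and \<epsilon> :: real
  assumes n: "n \<ge> 3" and \<epsilon>: "1 / sqrt (real n) < \<epsilon>" "\<epsilon> < 1"
  shows "\<exists>G :: nat wgraph. wf_wgraph G \<and> card (verts G) = n \<and>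
    (\<forall>H. triangle_cut_sparsifier \<epsilon> G H \<longrightarrow> real (card (edges H)) \<ge> 1 / 32000 * (real n / \<epsilon>\<^sup>2))"
proof -
  \<comment> \<open>\<open>t\<close> is the largest size of \<open>L\<close> that the cut norm
    argument admits; \<open>b\<close> rounds it down but stays at least 1 to keep \<open>L\<close>
    nonempty.\<close>
  define t where "t = 1 / (2000 * \<epsilon>\<^sup>2)"
  define b where "b = max 1 (nat \<lfloor>t\<rfloor>)"
  \<comment> \<open>Vertex 0 is reserved for the apex, and \<open>R\<close> takes all remaining
    vertices below \<open>n\<close>.\<close>
  define L R where "L = {1..b}" and "R = {b<..<n}"
  have "\<epsilon> > 0" using \<epsilon>(1) by (rule le_less_trans[rotated]) simp
  then have t: "t > 0" "2000 * \<epsilon>\<^sup>2 * t = 1" by (auto simp: t_def)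
  have "(1 / sqrt (real n))\<^sup>2 < \<epsilon>\<^sup>2" using \<epsilon>(1) by (intro power_strict_mono) auto
  then have "1 / \<epsilon>\<^sup>2 < real n" using n \<open>\<epsilon> > 0\<close> by (simp add: power_divide field_simps)
  \<comment> \<open>This is where \<epsilon> > 1/sqrt n is used: it keeps \<open>L\<close> small
    compared with \<open>n\<close>.\<close>
  then have tn: "2000 * t < real n" by (simp add: t_def)
  have target: "1 / 32000 * (real n / \<epsilon>\<^sup>2) = real n * t / 16" by (simp add: t_def)
  \<comment> \<open>Once \<open>t\<close> is at least 1, rounding down loses at most a factor
    2.\<close>
  have bt: "b = 1 \<and> t < 1 \<or> real b \<le> t \<and> t \<le> 2 * real b"
  proof (cases "t < 1")
    case True
    then have "nat \<lfloor>t\<rfloor> \<le> 1" by linarith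
    with True show ?thesis by (simp add: b_def)
  next
    case False
    then have "\<lfloor>t\<rfloor> \<ge> 1" by linarith
    then have "b = nat \<lfloor>t\<rfloor>" unfolding b_def by linarith
    with \<open>\<lfloor>t\<rfloor> \<ge> 1\<close> have "real b = of_int \<lfloor>t\<rfloor>" by simp
    with \<open>\<lfloor>t\<rfloor> \<ge> 1\<close> show ?thesis by linarith
  qed
  have "b \<ge> 1" by (simp add: b_def)
  \<comment> \<open>The factor 3 is sharp at \<open>n = 3\<close>, \<open>b = 1\<close>, where
    \<open>R\<close> is a single vertex.\<close>
  have m: "3 * real (n - 1 - b) \<ge> real n"
    using bt n tn \<open>b \<ge> 1\<close> by auto
  interpret cone "0::nat" L R
    by standard (auto simp: L_def R_def)
  have card: "card L = b" "card R = n - 1 - b" by (auto simp: L_def R_def)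
  have "card R > 0" using m n unfolding card by linarith
  have ne: "L \<noteq> {}" "R \<noteq> {}" using \<open>b \<ge> 1\<close> \<open>card R > 0\<close> by (auto simp: L_def)
  have "insert 0 (L \<union> R) = {..<n}" using \<open>card R > 0\<close> unfolding card by (auto simp: L_def R_def)
  then have "card (verts (cone_biclique 0 L R)) = n" by (simp add: cone_biclique_def)
  moreover have "real (card (edges H)) \<ge> 1 / 32000 * (real n / \<epsilon>\<^sup>2)"
    if H: "triangle_cut_sparsifier \<epsilon> (cone_biclique 0 L R) H" for H
  \<comment> \<open>For \<open>t < 1\<close> the count of one edge per column suffices, as
    \<open>1 / \<epsilon>\<^sup>2\<close> is then bounded.\<close>
  proof (cases "t < 1")
    case True
    have "real (card R) \<le> real (card (edges H))"
      using sparsifier_card_edges_ge_card[OF H \<epsilon>(2) ne(1)] by simp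
    moreover have "real n * t \<le> real n * 1" using True by (intro mult_left_mono) auto
    ultimately show ?thesis unfolding target using m card by simp
  next
    case False
    then have b: "real b \<le> t" "t \<le> 2 * real b" using bt by auto
    have "2000 * \<epsilon>\<^sup>2 * real (card L) \<le> 2000 * \<epsilon>\<^sup>2 * t"
      using b card by (intro mult_left_mono) auto
    then have "real b * real (n - 1 - b) \<le> 4 * real (card (edges H))"
      using sparsifier_card_edges_ge[OF H _ ne] \<open>\<epsilon> > 0\<close> t(2) card by simp
    \<comment> \<open>Here \<open>n\<close> exceeds 2000, so \<open>R\<close> has at least half of
      the vertices. The losses 2 for \<open>b\<close>, 2 for \<open>R\<close> and 4 for the support
      multiply to 16, and 16 * 2000 = 32000.\<close>
    moreover have "2 * real (n - 1 - b) \<ge> real n" using b tn \<open>b \<ge> 1\<close> by auto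
    then have "t / 2 * (real n / 2) \<le> real b * real (n - 1 - b)"
      using b t by (intro mult_mono) auto
    ultimately show ?thesis unfolding target by (simp add: mult.commute)
  qed
  ultimately show ?thesis using wf_cone_biclique by blast
qed

theorem theorem5p2:
  "\<exists>c::real. c > 0 \<and>
     (\<forall>(n::nat) (\<epsilon>::real). n \<ge> 3 \<longrightarrow> 1 / sqrt (real n) < \<epsilon> \<longrightarrow> \<epsilon> < 1 \<longrightarrow>
        (\<exists>G :: nat wgraph. wf_wgraph G \<and> card (verts G) = n \<and>
           (\<forall>G'. triangle_cut_sparsifier \<epsilon> G G' \<longrightarrow>
              real (card (edges G')) \<ge> c * (real n / \<epsilon>\<^sup>2))))"
  using sparsifier_lower_bound by (intro exI[of _ "1 / 32000"]) simp

end
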